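(* Let $\Gamma$ be a countable homogeneous relational $\tau$-structure with domain $D$, and let $\prec$ be a linear order on $D$ such that the expansion $\Gamma' := (\Gamma,\prec)$ (of signature $\tau\cup\{\prec\}$) is $\omega$-categorical, homogeneous and Ramsey. Suppose furthermore that every acyclic orbital of $\mathrm{Aut}(\Gamma)$ is also an orbital of $\mathrm{Aut}(\Gamma')$. Then the age of $\Gamma'$ has the ordering property with respect to $\prec$.
   Context: A structure is homogeneous if every isomorphism between finite substructures extends to an automorphism. The age of a structure is the class of all finite structures that embed into it. For structures $\mathfrak A,\mathfrak B$, $\binom{\mathfrak B}{\mathfrak A}$ denotes the set of embeddings of $\mathfrak A$ into $\mathfrak B$; for $r\in\mathbb N$, $\mathfrak C\to(\mathfrak B)^{\mathfrak A}_r$ means that for every $\chi\colon\binom{\mathfrak C}{\mathfrak A}\to\{1,\dots,r\}$ there is $f\in\binom{\mathfrak C}{\mathfrak B}$ with $|\chi(\{f\circ e: e\in\binom{\mathfrak B}{\mathfrak A}\})|\le 1$. A class $\mathcal C$ of finite structures has the Ramsey property if for all $\mathfrak A,\mathfrak B\in\mathcal C$ and $k\in\mathbb N$ there is $\mathfrak C\in\mathcal C$ with $\mathfrak C\to(\mathfrak B)^{\mathfrak A}_k$. A homogeneous structure is called Ramsey if its age has the Ramsey property. An orbital of a permutation group $G$ on $D$ is an orbit of the componentwise action of $G$ on $D^2$. For an orbital $O$, an $O$-cycle is a sequence of pairs $(u_1,u_2),(u_2,u_3),\dots,(u_n,u_1)$ all belonging to $O$, for some $n$; $O$ is cyclic if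 it contains an $O$-cycle and acyclic otherwise. Ordering property: let $\mathcal C'$ be a class of finite $(\tau\cup\{\prec\})$-structures in which $\prec$ denotes a linear order, and $\mathcal C$ the class of $\tau$-reducts of members of $\mathcal C'$. Then $\mathcal C'$ has the ordering property with respect to $\prec$ if for every $\mathfrak X\in\mathcal C$ there is $\mathfrak Y\in\mathcal C$ such that for all expansions $\mathfrak X'\in\mathcal C'$ of $\mathfrak X$ and $\mathfrak Y'\in\mathcal C'$ of $\mathfrak Y$ there is an embedding of $\mathfrak X'$ into $\mathfrak Y'$. *)

theory Defs
  imports Main "HOL-Library.FuncSet" "HOL-Library.Countable_Set"
begin

text \<open>A relational signature is a partial map: \<open>\<sigma> r = Some n\<close> says that \<open>r\<close> is a symbol of arity \<open>n\<close>.
  (A partial map rather than a total arity function on a type of symbols, so that the empty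
  signature is covered.)\<close>

type_synonym 'r signature = "'r \<rightharpoonup> nat"

record ('r, 'a) struct =
  univ :: "'a set"
  rel :: "'r \<Rightarrow> 'a list set"

text \<open>Symbols outside the signature are required to denote the empty relation. Hence the notions
  below that compare the interpretations of all \<open>r\<close> need not mention the signature, and two
  structures over \<open>\<sigma>\<close> are equal as records iff they are equal as \<open>\<sigma>\<close>-structures.\<close>

definition is_struct :: "'r signature \<Rightarrow> ('r, 'a) struct \<Rightarrow> bool" where
  "is_struct \<sigma> A \<longleftrightarrow>
     (\<forall>r. case \<sigma> r of
            None \<Rightarrow> rel A r = {}
          | Some n \<Rightarrow> rel A r \<subseteq> {xs. length xs = n \<and> set xs \<subseteq> univ A})"

definition substr :: "('r, 'a) struct \<Rightarrow> 'a set \<Rightarrow> ('r, 'a) struct" where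
  "substr A S = \<lparr>univ = S, rel = (\<lambda>r. rel A r \<inter> lists S)\<rparr>"

text \<open>Embeddings are extensional functions (undefined outside the domain), so that each
  embedding is represented by exactly one HOL function; composition is \<open>compose\<close>.\<close>

definition embeddings :: "('r, 'a) struct \<Rightarrow> ('r, 'b) struct \<Rightarrow> ('a \<Rightarrow> 'b) set" where
  "embeddings A B =
     {f \<in> univ A \<rightarrow>\<^sub>E univ B. inj_on f (univ A) \<and>
        (\<forall>r. \<forall>xs \<in> lists (univ A). xs \<in> rel A r \<longleftrightarrow> map f xs \<in> rel B r)}"

definition isomorphisms :: "('r, 'a) struct \<Rightarrow> ('r, 'b) struct \<Rightarrow> ('a \<Rightarrow> 'b) set" where
  "isomorphisms A B = {f \<in> embeddings A B. f ` univ A = univ B}"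

definition Aut :: "('r, 'a) struct \<Rightarrow> ('a \<Rightarrow> 'a) set" where
  "Aut A = isomorphisms A A"

definition homogeneous :: "('r, 'a) struct \<Rightarrow> bool" where
  "homogeneous A \<longleftrightarrow>
     (\<forall>S T. S \<subseteq> univ A \<and> T \<subseteq> univ A \<and> finite S \<and> finite T \<longrightarrow>
        (\<forall>f \<in> isomorphisms (substr A S) (substr A T). \<exists>g \<in> Aut A. \<forall>x\<in>S. g x = f x))"

text \<open>The age is closed under isomorphism; it is represented by its members whose domain is a
  (finite) set of natural numbers, which include a copy of every finite structure.\<close>

definition age :: "'r signature \<Rightarrow> ('r, 'a) struct \<Rightarrow> ('r, nat) struct set" where
  "age \<sigma> A = {B. is_struct \<sigma> B \<and> finite (univ B) \<and> embeddings B A \<noteq> {}}"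

definition ramsey_arrow ::
    "('r, 'a) struct \<Rightarrow> ('r, 'a) struct \<Rightarrow> ('r, 'a) struct \<Rightarrow> nat \<Rightarrow> bool" where
  "ramsey_arrow C B A k \<longleftrightarrow>
     (\<forall>\<chi> \<in> embeddings A C \<rightarrow> {1..k}. \<exists>f \<in> embeddings B C.
        card (\<chi> ` {compose (univ A) f e | e. e \<in> embeddings A B}) \<le> 1)"

definition ramsey_property :: "('r, 'a) struct set \<Rightarrow> bool" where
  "ramsey_property \<C> \<longleftrightarrow> (\<forall>A\<in>\<C>. \<forall>B\<in>\<C>. \<forall>k. \<exists>C\<in>\<C>. ramsey_arrow C B A k)"

definition ramsey :: "'r signature \<Rightarrow> ('r, 'a) struct \<Rightarrow> bool" where
  "ramsey \<sigma> A \<longleftrightarrow> homogeneous A \<and> ramsey_property (age \<sigma> A)"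

datatype 'r form =
    Atom 'r "nat list"
  | Eq nat nat
  | Neg "'r form"
  | Conj "'r form" "'r form"
  | Exists nat "'r form"

primrec form_over :: "'r signature \<Rightarrow> 'r form \<Rightarrow> bool" where
  "form_over \<sigma> (Atom r xs) \<longleftrightarrow> \<sigma> r = Some (length xs)"
| "form_over \<sigma> (Eq x y) \<longleftrightarrow> True"
| "form_over \<sigma> (Neg \<phi>) \<longleftrightarrow> form_over \<sigma> \<phi>"
| "form_over \<sigma> (Conj \<phi> \<psi>) \<longleftrightarrow> form_over \<sigma> \<phi> \<and> form_over \<sigma> \<psi>"
| "form_over \<sigma> (Exists x \<phi>) \<longleftrightarrow> form_over \<sigma> \<phi>"

primrec free_vars :: "'r form \<Rightarrow> nat set" where
  "free_vars (Atom r xs) = set xs"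
| "free_vars (Eq x y) = {x, y}"
| "free_vars (Neg \<phi>) = free_vars \<phi>"
| "free_vars (Conj \<phi> \<psi>) = free_vars \<phi> \<union> free_vars \<psi>"
| "free_vars (Exists x \<phi>) = free_vars \<phi> - {x}"

primrec sat :: "('r, 'a) struct \<Rightarrow> (nat \<Rightarrow> 'a) \<Rightarrow> 'r form \<Rightarrow> bool" where
  "sat A e (Atom r xs) \<longleftrightarrow> map e xs \<in> rel A r"
| "sat A e (Eq x y) \<longleftrightarrow> e x = e y"
| "sat A e (Neg \<phi>) \<longleftrightarrow> \<not> sat A e \<phi>"
| "sat A e (Conj \<phi> \<psi>) \<longleftrightarrow> sat A e \<phi> \<and> sat A e \<psi>"
| "sat A e (Exists x \<phi>) \<longleftrightarrow> (\<exists>d \<in> univ A. sat A (e(x := d)) \<phi>)"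

text \<open>The value of a sentence does not depend on the assignment \<open>e\<close>.\<close>

definition FO_theory :: "'r signature \<Rightarrow> ('r, 'a) struct \<Rightarrow> 'r form set" where
  "FO_theory \<sigma> A = {\<phi>. form_over \<sigma> \<phi> \<and> free_vars \<phi> = {} \<and> (\<forall>e. sat A e \<phi>)}"

definition is_model :: "'r signature \<Rightarrow> 'r form set \<Rightarrow> ('r, 'a) struct \<Rightarrow> bool" where
  "is_model \<sigma> T A \<longleftrightarrow> is_struct \<sigma> A \<and> (\<forall>\<phi>\<in>T. \<forall>e. sat A e \<phi>)"

text \<open>A countable structure is \<open>\<omega>\<close>-categorical if all countable models of its first-order theory
  are isomorphic. Every countable structure has a copy with domain a set of natural numbers, so
  it suffices to quantify over those. Countable includes finite.\<close>

definition omega_categorical :: "'r signature \<Rightarrow> ('r, 'a) struct \<Rightarrow> bool" where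
  "omega_categorical \<sigma> A \<longleftrightarrow> is_struct \<sigma> A \<and> countable (univ A) \<and>
     (\<forall>(B :: ('r, nat) struct) (C :: ('r, nat) struct).
        is_model \<sigma> (FO_theory \<sigma> A) B \<and> is_model \<sigma> (FO_theory \<sigma> A) C \<longrightarrow> isomorphisms B C \<noteq> {})"

text \<open>The signature \<open>\<tau> \<union> {\<prec>}\<close>: the new binary symbol \<open>\<prec>\<close> is \<open>None\<close>, an old symbol \<open>r\<close> is \<open>Some r\<close>.\<close>

definition order_sig :: "'r signature \<Rightarrow> 'r option signature" where
  "order_sig \<tau> = case_option (Some 2) \<tau>"

definition order_expansion :: "('r, 'a) struct \<Rightarrow> ('a \<times> 'a) set \<Rightarrow> ('r option, 'a) struct" where
  "order_expansion A L =
     \<lparr>univ = univ A, rel = case_option {[x, y] | x y. (x, y) \<in> L} (rel A)\<rparr>"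

definition order_reduct :: "('r option, 'a) struct \<Rightarrow> ('r, 'a) struct" where
  "order_reduct A = \<lparr>univ = univ A, rel = (\<lambda>r. rel A (Some r))\<rparr>"

definition orbitals :: "('a \<Rightarrow> 'a) set \<Rightarrow> 'a set \<Rightarrow> ('a \<times> 'a) set set" where
  "orbitals G D = {{(g x, g y) | g. g \<in> G} | x y. x \<in> D \<and> y \<in> D}"

text \<open>\<open>us = [u\<^sub>1, \<dots>, u\<^sub>n]\<close> with \<open>n \<ge> 1\<close> stands for the cycle
  \<open>(u\<^sub>1, u\<^sub>2), (u\<^sub>2, u\<^sub>3), \<dots>, (u\<^sub>n, u\<^sub>1)\<close>.\<close>

definition cyclic_orbital :: "('a \<times> 'a) set \<Rightarrow> bool" where
  "cyclic_orbital Q \<longleftrightarrow>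
     (\<exists>us. us \<noteq> [] \<and>
        (\<forall>i < length us. (us ! i, us ! (Suc i mod length us)) \<in> Q))"

text \<open>To be used for classes \<open>\<C>'\<close> of finite structures over some \<open>order_sig \<tau>\<close> in which \<open>\<prec>\<close>
  denotes a (strict) linear order.\<close>

definition ordering_property :: "('r option, 'a) struct set \<Rightarrow> bool" where
  "ordering_property \<C>' \<longleftrightarrow>
     (\<forall>X \<in> order_reduct ` \<C>'. \<exists>Y \<in> order_reduct ` \<C>'.
        \<forall>X' \<in> \<C>'. \<forall>Y' \<in> \<C>'. order_reduct X' = X \<and> order_reduct Y' = Y \<longrightarrow>
          embeddings X' Y' \<noteq> {})"

end

theory Submission
  imports Defs
begin

text \<open>Given \<open>X\<close>, take a finite \<open>Z\<close> in the age of \<open>\<Gamma>'\<close> that contains a copy of every ordered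
  expansion of \<open>X\<close> and, for each cyclic orbital \<open>Q\<close> of a pair from these copies, a \<open>Q\<close>-cycle. The
  Ramsey property, applied to all two-element substructures of \<open>Z\<close>, yields \<open>C\<close> such that for every
  expansion of the reduct \<open>Y\<close> of \<open>C\<close> there is a copy of \<open>Z\<close> in \<open>C\<close> on which the order of the
  expansion depends only on the types in \<open>\<Gamma>'\<close> of pairs. For each such orbital \<open>Q\<close> the new order then
  agrees with the old one on all pairs in \<open>Q\<close>, or disagrees on all of them: a mixed pattern would
  orient all pairs of \<open>Q\<close> in the same direction, against the cycle; and if \<open>Q\<close> is acyclic it is a
  single orbital of \<open>\<Gamma>'\<close>. Flipping the order of an expansion \<open>X'\<close> accordingly gives an expansion
  \<open>X''\<close> in the age; the copy of \<open>X''\<close> in \<open>Z\<close> is flipped back to \<open>X'\<close> by the new order.\<close>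

section \<open>Embeddings, induced structures, ages and homogeneity\<close>

lemma embeddingsI:
  assumes "f \<in> univ A \<rightarrow>\<^sub>E univ B" "inj_on f (univ A)"
    and "\<And>r xs. xs \<in> lists (univ A) \<Longrightarrow> xs \<in> rel A r \<longleftrightarrow> map f xs \<in> rel B r"
  shows "f \<in> embeddings A B"
  using assms unfolding embeddings_def by blast

lemma embeddingsD:
  assumes "f \<in> embeddings A B"
  shows "f \<in> univ A \<rightarrow>\<^sub>E univ B" "inj_on f (univ A)"
    and "x \<in> univ A \<Longrightarrow> f x \<in> univ B"
    and "xs \<in> lists (univ A) \<Longrightarrow> xs \<in> rel A r \<longleftrightarrow> map f xs \<in> rel B r"
  using assms unfolding embeddings_def by blast+

lemma map_compose: "xs \<in> lists A \<Longrightarrow> map (compose A g f) xs = map g (map f xs)"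
  by (auto simp: compose_eq)

lemma compose_in_embeddings:
  assumes f: "f \<in> embeddings A B" and g: "g \<in> embeddings B C"
  shows "compose (univ A) g f \<in> embeddings A C"
proof (rule embeddingsI)
  show "compose (univ A) g f \<in> univ A \<rightarrow>\<^sub>E univ C"
    using embeddingsD(3)[OF f] embeddingsD(3)[OF g] by (auto simp: compose_def)
  show "inj_on (compose (univ A) g f) (univ A)"
    using embeddingsD(2,3)[OF f] embeddingsD(2)[OF g]
    by (auto simp: inj_on_def compose_eq)
  fix r xs assume xs: "xs \<in> lists (univ A)"
  have "map f xs \<in> lists (univ B)"
    using xs embeddingsD(3)[OF f] by auto
  then show "xs \<in> rel A r \<longleftrightarrow> map (compose (univ A) g f) xs \<in> rel C r"
    using embeddingsD(4)[OF f xs] embeddingsD(4)[OF g] by (simp only: map_compose[OF xs])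
qed

lemma id_in_embeddings: "(\<lambda>x\<in>univ A. x) \<in> embeddings A A"
proof (rule embeddingsI)
  fix r xs assume "xs \<in> lists (univ A)"
  then have "map (\<lambda>x\<in>univ A. x) xs = xs" by (intro map_idI) auto
  then show "xs \<in> rel A r \<longleftrightarrow> map (\<lambda>x\<in>univ A. x) xs \<in> rel A r" by simp
qed (simp_all add: inj_on_def)

lemma id_in_Aut: "(\<lambda>x\<in>univ A. x) \<in> Aut A"
  using id_in_embeddings by (auto simp: Aut_def isomorphisms_def)

lemma Aut_embedding: "g \<in> Aut A \<Longrightarrow> g \<in> embeddings A A"
  by (simp add: Aut_def isomorphisms_def)

text \<open>Follow \<open>h\<close> by the inverse of \<open>b\<close> on its image. This brings
  copies found in \<open>M\<close> into \<open>B\<close>.\<close>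

lemma embedding_factor:
  assumes h: "h \<in> embeddings A M" and b: "b \<in> embeddings B M"
    and sub: "h ` univ A \<subseteq> b ` univ B"
  obtains k where "k \<in> embeddings A B" "\<And>x. x \<in> univ A \<Longrightarrow> b (k x) = h x"
proof
  define k where "k = (\<lambda>x\<in>univ A. inv_into (univ B) b (h x))"
  show bk: "b (k x) = h x" if "x \<in> univ A" for x
    using that sub by (auto simp: k_def intro!: f_inv_into_f)
  have kB: "k x \<in> univ B" if "x \<in> univ A" for x
    using that sub by (auto simp: k_def intro!: inv_into_into)
  show "k \<in> embeddings A B"
  proof (rule embeddingsI)
    show "k \<in> univ A \<rightarrow>\<^sub>E univ B" using kB by (auto simp: k_def)
    show "inj_on k (univ A)"
      using embeddingsD(2)[OF h] bk unfolding inj_on_def by metis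
    fix r xs assume xs: "xs \<in> lists (univ A)"
    then have "map b (map k xs) = map h xs" "map k xs \<in> lists (univ B)"
      using bk kB by auto
    then show "xs \<in> rel A r \<longleftrightarrow> map k xs \<in> rel B r"
      using embeddingsD(4)[OF h xs] embeddingsD(4)[OF b] by metis
  qed
qed

text \<open>For \<open>f\<close> injective from \<open>S\<close> into \<open>univ M\<close> this is
  a copy of a substructure of \<open>M\<close> on a domain of choice. Taking finite \<open>S\<close>
  among the natural numbers gives members of the age.\<close>

definition pullback :: "('r, 'a) struct \<Rightarrow> 'b set \<Rightarrow> ('b \<Rightarrow> 'a) \<Rightarrow> ('r, 'b) struct" where
  "pullback M S f = \<lparr>univ = S, rel = (\<lambda>r. {xs \<in> lists S. map f xs \<in> rel M r})\<rparr>"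

lemma univ_pullback [simp]: "univ (pullback M S f) = S"
  by (simp add: pullback_def)

lemma is_struct_pullback:
  assumes "is_struct \<sigma> M"
  shows "is_struct \<sigma> (pullback M S f)"
  unfolding is_struct_def
proof
  fix r
  show "case \<sigma> r of None \<Rightarrow> rel (pullback M S f) r = {}
    | Some n \<Rightarrow> rel (pullback M S f) r \<subseteq> {xs. length xs = n \<and> set xs \<subseteq> univ (pullback M S f)}"
    using assms[unfolded is_struct_def, rule_format, of r]
    by (auto simp: pullback_def split: option.splits)
qed

lemma pullback_embedding:
  assumes "f ` S \<subseteq> univ M" "inj_on f S"
  shows "restrict f S \<in> embeddings (pullback M S f) M"
proof (rule embeddingsI)
  fix r xs assume xs: "xs \<in> lists (univ (pullback M S f))"
  then have eq: "map (restrict f S) xs = map f xs" by auto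
  show "xs \<in> rel (pullback M S f) r \<longleftrightarrow> map (restrict f S) xs \<in> rel M r"
    unfolding eq using xs by (simp add: pullback_def)
qed (use assms in \<open>auto simp: inj_on_def\<close>)

lemma pullback_in_age:
  assumes "is_struct \<sigma> M" "f ` S \<subseteq> univ M" "inj_on f S" "finite S"
  shows "pullback M S f \<in> age \<sigma> M"
  using is_struct_pullback[OF assms(1)] pullback_embedding[OF assms(2,3)] assms(4)
  by (auto simp: age_def)

text \<open>The age only contains structures on natural numbers, so \<open>T\<close> is transported
  along an enumeration by \<open>{..<card T}\<close>.\<close>

lemma finite_subset_in_age:
  assumes "is_struct \<sigma> M" "T \<subseteq> univ M" "finite T"
  obtains B b where "B \<in> age \<sigma> M" "b \<in> embeddings B M" "b ` univ B = T"
proof -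
  obtain f where f: "bij_betw f {..<card T} T"
    using ex_bij_betw_nat_finite[OF assms(3)] by (auto simp: atLeast0LessThan)
  then have *: "f ` {..<card T} \<subseteq> univ M" "inj_on f {..<card T}"
    using assms(2) by (auto simp: bij_betw_def)
  show thesis
    by (rule that[OF pullback_in_age[OF assms(1) *] pullback_embedding[OF *]])
      (use f in \<open>auto simp: bij_betw_def\<close>)
qed

lemma age_if_embedding:
  assumes "B \<in> age \<sigma> M" "is_struct \<sigma> A" "finite (univ A)" "f \<in> embeddings A B"
  shows "A \<in> age \<sigma> M"
  using assms compose_in_embeddings unfolding age_def by blast

text \<open>The map \<open>h'\<close> after the inverse of \<open>h\<close> is an isomorphism
  between the two finite images of \<open>A\<close>, to which the definition of homogeneity
  applies.\<close>

lemma homogeneous_extend: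
  assumes hom: "homogeneous M" and fin: "finite (univ A)"
    and h: "h \<in> embeddings A M" and h': "h' \<in> embeddings A M"
  obtains g where "g \<in> Aut M" "\<And>x. x \<in> univ A \<Longrightarrow> g (h x) = h' x"
proof -
  let ?S = "h ` univ A" and ?T = "h' ` univ A"
  define i where "i = (\<lambda>y\<in>?S. h' (inv_into (univ A) h y))"
  have i: "i (h x) = h' x" if "x \<in> univ A" for x
    using that embeddingsD(2)[OF h] by (simp add: i_def)
  have "i \<in> embeddings (substr M ?S) (substr M ?T)"
  proof (rule embeddingsI)
    show "i \<in> univ (substr M ?S) \<rightarrow>\<^sub>E univ (substr M ?T)"
      using i by (auto simp: substr_def) (simp add: i_def)
    show "inj_on i (univ (substr M ?S))"
      using i embeddingsD(2)[OF h'] by (auto simp: substr_def inj_on_def)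
    fix r ys assume "ys \<in> lists (univ (substr M ?S))"
    then have "ys \<in> map h ` lists (univ A)"
      by (simp add: substr_def lists_image)
    then obtain xs where xs: "xs \<in> lists (univ A)" and ys: "ys = map h xs" by auto
    have *: "map i ys = map h' xs" using xs i by (auto simp: ys)
    show "ys \<in> rel (substr M ?S) r \<longleftrightarrow> map i ys \<in> rel (substr M ?T) r"
      unfolding * unfolding ys
      using xs embeddingsD(4)[OF h xs, of r] embeddingsD(4)[OF h' xs, of r]
      by (auto simp: substr_def lists_image)
  qed
  moreover have "i ` ?S = ?T" using i by force
  ultimately have "i \<in> isomorphisms (substr M ?S) (substr M ?T)"
    by (simp add: isomorphisms_def substr_def)
  moreover have "?S \<subseteq> univ M" "?T \<subseteq> univ M"
    using embeddingsD(3)[OF h] embeddingsD(3)[OF h'] by auto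
  moreover have "finite ?S" "finite ?T" using fin by simp_all
  ultimately have "\<exists>g\<in>Aut M. \<forall>y\<in>?S. g y = i y"
    using hom[unfolded homogeneous_def, rule_format, of ?S ?T i] by simp
  then obtain g where g: "g \<in> Aut M" "\<forall>y\<in>?S. g y = i y" by blast
  show thesis
    by (rule that[OF g(1)]) (use g(2) i in simp)
qed

section \<open>The Ramsey property for finitely many structures at once\<close>

text \<open>Each predicate \<open>P A\<close> is a 2-colouring of the copies of \<open>A\<close>.
  The induction puts a Ramsey arrow for the new \<open>A\<close> around the structure
  \<open>C\<^sub>1\<close> obtained for the old ones. \<open>C\<close> is fixed before
  \<open>P\<close>, so it serves for colourings chosen later.\<close>

lemma ramsey_simultaneous:
  fixes \<C> :: "('a, 'b) struct set"
  assumes ram: "ramsey_property \<C>" and "finite \<A>" "\<A> \<subseteq> \<C>" and B: "B \<in> \<C>"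
  shows "\<exists>C\<in>\<C>. \<forall>P. \<exists>f\<in>embeddings B C. \<forall>A\<in>\<A>. \<forall>e\<in>embeddings A B. \<forall>e'\<in>embeddings A B.
    P A (compose (univ A) f e) \<longleftrightarrow> P A (compose (univ A) f e')"
  using assms(2,3)
proof (induction \<A>)
  case empty
  show ?case using B id_in_embeddings by blast
next
  case (insert A \<A>)
  then obtain C\<^sub>1 where C1: "C\<^sub>1 \<in> \<C>"
    and hom: "\<forall>P. \<exists>f\<in>embeddings B C\<^sub>1. \<forall>A\<in>\<A>. \<forall>e\<in>embeddings A B. \<forall>e'\<in>embeddings A B.
      P A (compose (univ A) f e) \<longleftrightarrow> P A (compose (univ A) f e')"
    by auto
  obtain C where C: "C \<in> \<C>" and arrow: "ramsey_arrow C C\<^sub>1 A 2"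
    using ram C1 insert.prems unfolding ramsey_property_def by blast
  show ?case
  proof (intro bexI[OF _ C] allI)
    fix P :: "('a, 'b) struct \<Rightarrow> ('b \<Rightarrow> 'b) \<Rightarrow> bool"
    define \<chi> :: "('b \<Rightarrow> 'b) \<Rightarrow> nat" where "\<chi> e = (if P A e then 1 else 2)" for e
    have "\<chi> \<in> embeddings A C \<rightarrow> {1..2}" by (simp add: \<chi>_def)
    then obtain g where g: "g \<in> embeddings C\<^sub>1 C"
      and card: "card (\<chi> ` {compose (univ A) g e | e. e \<in> embeddings A C\<^sub>1}) \<le> 1"
      using arrow unfolding ramsey_arrow_def by blast
    define S where "S = \<chi> ` {compose (univ A) g e | e. e \<in> embeddings A C\<^sub>1}"
    \<comment> \<open>The bound on \<open>card\<close> alone says nothing about infinite sets, whose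
      \<open>card\<close> is 0.\<close>
    have "finite S"
      by (rule finite_subset[of _ "{1, 2}"]) (auto simp: S_def \<chi>_def)
    with card have "\<forall>m\<in>S. \<forall>n\<in>S. m = n"
      using card_le_Suc0_iff_eq[of S] by (simp add: S_def[symmetric])
    moreover have "\<chi> (compose (univ A) g e) \<in> S" if "e \<in> embeddings A C\<^sub>1" for e
      unfolding S_def using that by blast
    ultimately have \<chi>: "\<chi> (compose (univ A) g e) = \<chi> (compose (univ A) g e')"
      if "e \<in> embeddings A C\<^sub>1" "e' \<in> embeddings A C\<^sub>1" for e e'
      using that by blast
    have "P A e \<longleftrightarrow> \<chi> e = 1" for e by (simp add: \<chi>_def)
    then have gA: "P A (compose (univ A) g e) \<longleftrightarrow> P A (compose (univ A) g e')"
      if "e \<in> embeddings A C\<^sub>1" "e' \<in> embeddings A C\<^sub>1" for e e'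
      using \<chi>[OF that] by simp
    \<comment> \<open>The induction hypothesis is applied to the colouring pulled back along
      \<open>g\<close> from \<open>C\<close> to \<open>C\<^sub>1\<close>.\<close>
    obtain f where f: "f \<in> embeddings B C\<^sub>1"
      and fA: "\<forall>A\<in>\<A>. \<forall>e\<in>embeddings A B. \<forall>e'\<in>embeddings A B.
        P A (compose (univ A) g (compose (univ A) f e)) \<longleftrightarrow>
        P A (compose (univ A) g (compose (univ A) f e'))"
      using hom[rule_format, of "\<lambda>A e. P A (compose (univ A) g e)"] by blast
    have assoc: "compose (univ A) (compose (univ B) g f) e
        = compose (univ A) g (compose (univ A) f e)" if "e \<in> embeddings A B" for A e
      using embeddingsD(3)[OF that] by (auto simp: compose_def fun_eq_iff)
    show "\<exists>f\<in>embeddings B C. \<forall>A\<in>insert A \<A>. \<forall>e\<in>embeddings A B. \<forall>e'\<in>embeddings A B.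
        P A (compose (univ A) f e) \<longleftrightarrow> P A (compose (univ A) f e')"
    proof (intro bexI[OF _ compose_in_embeddings[OF f g]] ballI)
      fix A' e e'
      assume A': "A' \<in> insert A \<A>" and e: "e \<in> embeddings A' B" "e' \<in> embeddings A' B"
      show "P A' (compose (univ A') (compose (univ B) g f) e) \<longleftrightarrow>
          P A' (compose (univ A') (compose (univ B) g f) e')"
        unfolding assoc[OF e(1)] assoc[OF e(2)]
        using A' gA[OF compose_in_embeddings[OF _ f] compose_in_embeddings[OF _ f]] fA e by blast
    qed
  qed
qed

section \<open>Cycles against linear orders\<close>

lemma no_cycle_in_strict_order:
  assumes "trans R" "irrefl R" "us \<noteq> []"
    and cyc: "\<And>i. i < length us \<Longrightarrow> (us ! i, us ! (Suc i mod length us)) \<in> R"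
  shows False
proof -
  have "(us ! 0, us ! (Suc i mod length us)) \<in> R" if "i < length us" for i
    using that
  proof (induction i)
    case 0
    with cyc show ?case by blast
  next
    case (Suc i)
    then have "(us ! 0, us ! Suc i) \<in> R" by simp
    with cyc[OF Suc.prems] show ?case using \<open>trans R\<close> by (meson transD)
  qed
  \<comment> \<open>At the last index the successor wraps round to 0.\<close>
  from this[of "length us - 1"] have "(us ! 0, us ! 0) \<in> R"
    using \<open>us \<noteq> []\<close> by simp
  with \<open>irrefl R\<close> show False by (simp add: irrefl_def)
qed

text \<open>If \<open>R\<close> agreed with \<open>L\<close> on the increasing but not on the decreasing pairs of \<open>Q\<close>, or
  vice versa, it would orient all pairs of \<open>Q\<close> the same way, which a cycle rules out.\<close>

lemma same_orientation:
  assumes R: "strict_linear_order_on T R"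
    and hom: "\<And>p q p' q'. (p, q) \<in> Q \<inter> T \<times> T \<Longrightarrow> (p', q') \<in> Q \<inter> T \<times> T \<Longrightarrow>
      ((p, q) \<in> L \<longleftrightarrow> (p', q') \<in> L) \<Longrightarrow> ((p, q) \<in> R \<longleftrightarrow> (p', q') \<in> R)"
    and irr: "\<And>p q. (p, q) \<in> Q \<Longrightarrow> p \<noteq> q"
    and us: "us \<noteq> []" "set us \<subseteq> T"
      "\<And>i. i < length us \<Longrightarrow> (us ! i, us ! (Suc i mod length us)) \<in> Q"
    and pq: "(p, q) \<in> Q \<inter> T \<times> T" and pq': "(p', q') \<in> Q \<inter> T \<times> T"
  shows "((p, q) \<in> R \<longleftrightarrow> (p, q) \<in> L) \<longleftrightarrow> ((p', q') \<in> R \<longleftrightarrow> (p', q') \<in> L)"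
proof (rule ccontr)
  assume neg: "\<not> ?thesis"
  then have "(p, q) \<in> L \<longleftrightarrow> (p', q') \<notin> L" "(p, q) \<in> R \<longleftrightarrow> (p', q') \<in> R"
    using hom[OF pq pq'] by blast+
  \<comment> \<open>The two given pairs differ in \<open>L\<close> and agree in \<open>R\<close>;
    any further pair matches one of them in \<open>L\<close> and so inherits their common status in
    \<open>R\<close>.\<close>
  then have const: "(u, v) \<in> R \<longleftrightarrow> (p, q) \<in> R" if "(u, v) \<in> Q \<inter> T \<times> T" for u v
    using hom[OF that pq] hom[OF that pq'] by blast
  have cyc: "(us ! i, us ! (Suc i mod length us)) \<in> Q \<inter> T \<times> T" if "i < length us" for i
    using us that by (auto simp: subset_iff)
  show False
  proof (cases "(p, q) \<in> R")
    case True
    then show False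
      using no_cycle_in_strict_order[of R us] R us(1) const cyc
      by (simp add: strict_linear_order_on_def)
  next
    case False
    \<comment> \<open>No pair of \<open>Q\<close> within \<open>T\<close> lies in \<open>R\<close>
      now, and \<open>irr\<close> excludes loops, so totality puts the reversed pairs into
      \<open>R\<close>.\<close>
    have "(us ! i, us ! (Suc i mod length us)) \<in> R\<inverse>" if "i < length us" for i
      using R False const[OF cyc[OF that]] cyc[OF that] irr
      by (auto simp: strict_linear_order_on_def total_on_def)
    then show False
      using no_cycle_in_strict_order[of "R\<inverse>" us] R us(1)
      by (simp add: strict_linear_order_on_def irrefl_def)
  qed
qed

section \<open>Ordered expansions and their reducts\<close>

lemma univ_order_expansion [simp]: "univ (order_expansion A L) = univ A"
  by (simp add: order_expansion_def)

lemma rel_order_expansion [simp]: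
  "rel (order_expansion A L) (Some r) = rel A r"
  "[x, y] \<in> rel (order_expansion A L) None \<longleftrightarrow> (x, y) \<in> L"
  by (auto simp: order_expansion_def)

lemma order_reduct_eqD:
  assumes "order_reduct A = order_reduct B"
  shows "univ A = univ B" "rel A (Some r) = rel B (Some r)"
  using assms by (auto simp: order_reduct_def fun_eq_iff)

lemma order_reduct_embedding:
  assumes "h \<in> embeddings A (order_expansion M L)"
  shows "h \<in> embeddings (order_reduct A) M"
proof (rule embeddingsI)
  fix r xs assume "xs \<in> lists (univ (order_reduct A))"
  then show "xs \<in> rel (order_reduct A) r \<longleftrightarrow> map h xs \<in> rel M r"
    using embeddingsD(4)[OF assms, of xs "Some r"] by (simp add: order_reduct_def)
qed (use embeddingsD(1,2)[OF assms] in \<open>simp_all add: order_reduct_def\<close>)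

lemma length_order_rel:
  assumes "is_struct (order_sig \<tau>) A" "xs \<in> rel A None"
  shows "length xs = 2" "set xs \<subseteq> univ A"
  using assms(1)[unfolded is_struct_def, rule_format, of None] assms(2)
  by (auto simp: order_sig_def)

text \<open>\<open>is_struct\<close> confines the order symbol to lists of length 2, so lists of
  other lengths lie in neither relation and only pairs remain to be checked.\<close>

lemma embeddings_orderI:
  assumes A: "is_struct (order_sig \<tau>) A" and B: "is_struct (order_sig \<tau>) B"
    and "f \<in> univ A \<rightarrow>\<^sub>E univ B" "inj_on f (univ A)"
    and some: "\<And>r xs. xs \<in> lists (univ A) \<Longrightarrow> xs \<in> rel A (Some r) \<longleftrightarrow> map f xs \<in> rel B (Some r)"
    and none: "\<And>x y. x \<in> univ A \<Longrightarrow> y \<in> univ A \<Longrightarrow> [x, y] \<in> rel A None \<longleftrightarrow> [f x, f y] \<in> rel B None"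
  shows "f \<in> embeddings A B"
proof (rule embeddingsI)
  fix r xs assume xs: "xs \<in> lists (univ A)"
  show "xs \<in> rel A r \<longleftrightarrow> map f xs \<in> rel B r"
  proof (cases r)
    case None
    show ?thesis
    proof (cases "length xs = 2")
      case True
      then obtain x y where "xs = [x, y]" by (auto simp: length_Suc_conv numeral_2_eq_2)
      then show ?thesis using xs none None by simp
    next
      case False
      then show ?thesis
        using length_order_rel(1)[OF A] length_order_rel(1)[OF B, of "map f xs"] None by auto
    qed
  qed (use some xs in simp)
qed (use assms in auto)

text \<open>An expansion is determined by its order relation, a set of lists of length 2 over a
  finite set. This allows one finite structure to accommodate all expansions.\<close>

lemma finite_order_expansions:
  fixes A :: "('a, 'b) struct"
  assumes "finite (univ A)"
  shows "finite {B. is_struct (order_sig \<tau>) B \<and> order_reduct B = A}"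
proof (rule finite_subset)
  let ?F = "\<lambda>R. \<lparr>univ = univ A, rel = case_option R (rel A)\<rparr>"
  show "{B. is_struct (order_sig \<tau>) B \<and> order_reduct B = A}
      \<subseteq> ?F ` Pow {xs. set xs \<subseteq> univ A \<and> length xs = 2}"
  proof safe
    fix B :: "('a option, 'b) struct" assume B: "is_struct (order_sig \<tau>) B"
    have "B = \<lparr>univ = univ B, rel = case_option (rel B None) (\<lambda>r. rel B (Some r))\<rparr>"
      by (cases B) (auto simp: fun_eq_iff split: option.split)
    then show "B \<in> (\<lambda>R. \<lparr>univ = univ (order_reduct B), rel = case_option R (rel (order_reduct B))\<rparr>) `
        Pow {xs. set xs \<subseteq> univ (order_reduct B) \<and> length xs = 2}"
      using length_order_rel[OF B]
      by (intro image_eqI[where x = "rel B None"]) (auto simp: order_reduct_def)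
  qed
  show "finite (?F ` Pow {xs. set xs \<subseteq> univ A \<and> length xs = 2})"
    using finite_lists_length_eq[OF assms] by simp
qed

section \<open>Orbitals and types of pairs\<close>

lemma in_orbitalI: "x \<in> D \<Longrightarrow> y \<in> D \<Longrightarrow> {(g x, g y) | g. g \<in> G} \<in> orbitals G D"
  by (auto simp: orbitals_def)

text \<open>Automorphisms of the expansion preserve \<open>L\<close>, so all images of one pair have
  the same status in \<open>L\<close>.\<close>

lemma orbital_of_Aut_order_expansion:
  assumes Q: "Q \<in> orbitals (Aut (order_expansion M L)) (univ M)"
    and "(p, q) \<in> Q" "(p', q') \<in> Q"
  shows "(p, q) \<in> L \<longleftrightarrow> (p', q') \<in> L"
proof -
  obtain x y where xy: "x \<in> univ M" "y \<in> univ M"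
    and Q': "Q = {(g x, g y) | g. g \<in> Aut (order_expansion M L)}"
    using Q by (auto simp: orbitals_def)
  have "(u, v) \<in> L \<longleftrightarrow> (x, y) \<in> L" if uv: "(u, v) \<in> Q" for u v
  proof -
    obtain g where "g \<in> embeddings (order_expansion M L) (order_expansion M L)"
      "u = g x" "v = g y"
      using uv Q' Aut_embedding by blast
    then show ?thesis
      using embeddingsD(4)[of g "order_expansion M L" _ "[x, y]" None] xy by simp
  qed
  with assms(2,3) show ?thesis by blast
qed

lemma strict_linear_order_on_flip:
  assumes "strict_linear_order_on D L" "a \<in> D" "b \<in> D" "a \<noteq> b"
  shows "(b, a) \<in> L \<longleftrightarrow> (a, b) \<notin> L"
proof -
  have "(a, b) \<in> L \<or> (b, a) \<in> L"
    using assms by (simp add: strict_linear_order_on_def total_on_def)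
  moreover have "\<not> ((a, b) \<in> L \<and> (b, a) \<in> L)"
    using assms(1) by (metis strict_linear_order_on_def irreflD transD)
  ultimately show ?thesis by blast
qed

text \<open>\<open>g\<close> and \<open>g'\<close> preserve the relations of \<open>M\<close>, and
  the order on \<open>{0, 1}\<close> is settled by the direction from \<open>0\<close> to
  \<open>1\<close>. The labels turn equal types into equal structures, so that both pairs are
  coloured as copies of a single structure.\<close>

lemma pullback_pair_eq:
  assumes L: "strict_linear_order_on (univ M) L"
    and g: "g \<in> embeddings M M" and g': "g' \<in> embeddings M M"
    and pq: "p \<in> univ M" "q \<in> univ M" "p \<noteq> q"
    and ord: "(g p, g q) \<in> L \<longleftrightarrow> (g' p, g' q) \<in> L"
  shows "pullback (order_expansion M L) {0, 1::nat} (\<lambda>i. if i = 0 then g p else g q) =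
    pullback (order_expansion M L) {0, 1} (\<lambda>i. if i = 0 then g' p else g' q)"
    (is "pullback _ _ ?h = pullback _ _ ?h'")
proof -
  have *: "g p \<in> univ M" "g q \<in> univ M" "g p \<noteq> g q" "g' p \<in> univ M" "g' q \<in> univ M" "g' p \<noteq> g' q"
    using embeddingsD(3)[OF g] embeddingsD(3)[OF g'] pq
      inj_on_eq_iff[OF embeddingsD(2)[OF g]] inj_on_eq_iff[OF embeddingsD(2)[OF g']]
    by simp_all
  have "(g q, g p) \<in> L \<longleftrightarrow> (g' q, g' p) \<in> L"
    using strict_linear_order_on_flip[OF L *(1-3)] strict_linear_order_on_flip[OF L *(4-6)] ord
    by blast
  then have ord': "(?h i, ?h j) \<in> L \<longleftrightarrow> (?h' i, ?h' j) \<in> L" if "i \<in> {0, 1}" "j \<in> {0, 1}" for i j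
    using that ord L by (auto simp: strict_linear_order_on_def irrefl_def)
  have "map ?h is \<in> rel (order_expansion M L) r \<longleftrightarrow> map ?h' is \<in> rel (order_expansion M L) r"
    if "is": "is \<in> lists {0, 1}" for "is" r
  proof (cases r)
    case None
    show ?thesis
    proof (cases "length is = 2")
      case True
      then obtain i j where "is = [i, j]" by (auto simp: length_Suc_conv numeral_2_eq_2)
      then show ?thesis using "is" ord'[of i j] None by simp
    next
      case False
      have "length xs = 2" if "xs \<in> rel (order_expansion M L) None" for xs
        using that by (auto simp: order_expansion_def)
      then show ?thesis using False None by (metis length_map)
    qed
  next
    case (Some s)
    let ?pq = "map (\<lambda>i. if i = 0 then p else q) is"
    have "?pq \<in> lists (univ M)" using pq by auto
    moreover have "map ?h is = map g ?pq" "map ?h' is = map g' ?pq" by simp_all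
    ultimately show ?thesis
      using embeddingsD(4)[OF g, of ?pq s] embeddingsD(4)[OF g', of ?pq s] Some
      by (simp only: rel_order_expansion)
  qed
  then show ?thesis by (auto simp: pullback_def)
qed

section \<open>From the Ramsey property to the ordering property\<close>

theorem theorem6p4:
  fixes \<tau> :: "'r signature"
    and \<Gamma> :: "('r, 'a) struct"
    and L :: "('a \<times> 'a) set"
    and \<Gamma>' :: "('r option, 'a) struct"
  defines "\<Gamma>' \<equiv> order_expansion \<Gamma> L"
  assumes "is_struct \<tau> \<Gamma>" and "countable (univ \<Gamma>)" and "homogeneous \<Gamma>"
    and "L \<subseteq> univ \<Gamma> \<times> univ \<Gamma>" and "strict_linear_order_on (univ \<Gamma>) L"
    and "omega_categorical (order_sig \<tau>) \<Gamma>'"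
    and "homogeneous \<Gamma>'"
    and "ramsey (order_sig \<tau>) \<Gamma>'"
    and "\<And>Q. Q \<in> orbitals (Aut \<Gamma>) (univ \<Gamma>) \<Longrightarrow> \<not> cyclic_orbital Q \<Longrightarrow>
               Q \<in> orbitals (Aut \<Gamma>') (univ \<Gamma>')"
  shows "ordering_property (age (order_sig \<tau>) \<Gamma>')"
  unfolding ordering_property_def
proof
  let ?\<sigma> = "order_sig \<tau>"
  let ?\<C> = "age ?\<sigma> \<Gamma>'"
  note L = assms(6)
  have str: "is_struct ?\<sigma> \<Gamma>'" using assms(7) by (simp add: omega_categorical_def)
  have age_str: "is_struct ?\<sigma> B" if "B \<in> ?\<C>" for B using that by (simp add: age_def)
  have univ': "univ \<Gamma>' = univ \<Gamma>" by (simp add: \<Gamma>'_def)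
  have order: "(u x, u y) \<in> L \<longleftrightarrow> [x, y] \<in> rel A None"
    if "u \<in> embeddings A \<Gamma>'" "x \<in> univ A" "y \<in> univ A" for u A x y
    using embeddingsD(4)[OF that(1), of "[x, y]" None] that(2,3) by (simp add: \<Gamma>'_def)
  \<comment> \<open>These are orbitals of \<open>Aut \<Gamma>\<close>, not of
    \<open>Aut \<Gamma>'\<close>; one of them may contain pairs of both directions.\<close>
  define orb where "orb p q = {(g p, g q) | g. g \<in> Aut \<Gamma>}" for p q
  fix X assume "X \<in> order_reduct ` ?\<C>"
  then have fin_X: "finite (univ X)" by (auto simp: age_def order_reduct_def)
  define \<X> where "\<X> = {X' \<in> ?\<C>. order_reduct X' = X}"
  have "finite \<X>"
    by (rule finite_subset[OF _ finite_order_expansions[OF fin_X, of \<tau>]])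
      (auto simp: \<X>_def age_str)
  have univ_X: "univ X' = univ X" if "X' \<in> \<X>" for X'
    using that by (auto simp: \<X>_def order_reduct_def)
  have "\<forall>X'\<in>\<X>. \<exists>h. h \<in> embeddings X' \<Gamma>'" by (auto simp: \<X>_def age_def)
  then obtain h where h: "\<And>X'. X' \<in> \<X> \<Longrightarrow> h X' \<in> embeddings X' \<Gamma>'" by metis
  define T\<^sub>0 where "T\<^sub>0 = (\<Union>X'\<in>\<X>. h X' ` univ X')"
  have hT0: "h X' x \<in> T\<^sub>0" if "X' \<in> \<X>" "x \<in> univ X" for X' x
    using that univ_X[OF that(1)] by (auto simp: T\<^sub>0_def)
  have T0: "finite T\<^sub>0" "T\<^sub>0 \<subseteq> univ \<Gamma>"
    using \<open>finite \<X>\<close> fin_X univ_X embeddingsD(3)[OF h] univ' by (fastforce simp: T\<^sub>0_def)+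
  define is_cycle where "is_cycle Q us \<longleftrightarrow> us \<noteq> [] \<and>
    (\<forall>i < length us. (us ! i, us ! (Suc i mod length us)) \<in> Q)" for Q and us :: "'a list"
  \<comment> \<open>A list is to be chosen for every pair; if the orbital is acyclic, the default is
    \<open>[]\<close>.\<close>
  have "\<exists>us. set us \<subseteq> univ \<Gamma> \<and> (cyclic_orbital (orb p q) \<longrightarrow> is_cycle (orb p q) us)"
    if "p \<in> T\<^sub>0" "q \<in> T\<^sub>0" for p q
  proof (cases "cyclic_orbital (orb p q)")
    case True
    then obtain us where us: "is_cycle (orb p q) us"
      by (auto simp: cyclic_orbital_def is_cycle_def)
    have "orb p q \<subseteq> univ \<Gamma> \<times> univ \<Gamma>"
      using that T0 embeddingsD(3)[OF Aut_embedding] by (fastforce simp: orb_def)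
    with us have "set us \<subseteq> univ \<Gamma>"
      by (fastforce simp: is_cycle_def in_set_conv_nth)
    with us show ?thesis by blast
  qed (auto intro: exI[of _ "[]"])
  then obtain cyc where cyc: "\<And>p q. p \<in> T\<^sub>0 \<Longrightarrow> q \<in> T\<^sub>0 \<Longrightarrow> set (cyc p q) \<subseteq> univ \<Gamma>"
    "\<And>p q. p \<in> T\<^sub>0 \<Longrightarrow> q \<in> T\<^sub>0 \<Longrightarrow> cyclic_orbital (orb p q) \<Longrightarrow> is_cycle (orb p q) (cyc p q)"
    by metis
  \<comment> \<open>The points of the cycles are added so that the cycles survive in the finite
    structure \<open>Z\<close>.\<close>
  define T where "T = T\<^sub>0 \<union> (\<Union>p\<in>T\<^sub>0. \<Union>q\<in>T\<^sub>0. set (cyc p q))"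
  have T: "finite T" "T \<subseteq> univ \<Gamma>"
    using T0 cyc(1) by (auto simp: T_def)
  obtain Z b where Z: "Z \<in> ?\<C>" and b: "b \<in> embeddings Z \<Gamma>'" and bT: "b ` univ Z = T"
    using finite_subset_in_age[OF str, of T] T univ' by metis
  \<comment> \<open>The labels \<open>0\<close> and \<open>1\<close> record which point comes first,
    so \<open>pair p q\<close> encodes the quantifier-free type of \<open>(p, q)\<close> in
    \<open>\<Gamma>'\<close>.\<close>
  define pt where "pt p q = (\<lambda>i::nat. if i = 0 then p else q)" for p q :: 'a
  define pair where "pair p q = pullback \<Gamma>' {0, 1} (pt p q)" for p q
  define \<A> where "\<A> = {pair p q | p q. p \<in> T \<and> q \<in> T \<and> p \<noteq> q}"
  have pt: "pt p q ` {0, 1} \<subseteq> univ \<Gamma>'" "inj_on (pt p q) {0, 1}"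
    if "p \<in> T" "q \<in> T" "p \<noteq> q" for p q
    using that T by (auto simp: pt_def univ')
  have "finite \<A>"
    by (rule finite_subset[of _ "(\<lambda>(p, q). pair p q) ` (T \<times> T)"]) (use T in \<open>auto simp: \<A>_def\<close>)
  moreover have "\<A> \<subseteq> ?\<C>"
    using pullback_in_age[OF str pt] by (auto simp: \<A>_def pair_def)
  ultimately obtain C where C: "C \<in> ?\<C>" and C_hom: "\<And>P. \<exists>f\<in>embeddings Z C.
      \<forall>A\<in>\<A>. \<forall>e\<in>embeddings A Z. \<forall>e'\<in>embeddings A Z.
        P A (compose (univ A) f e) \<longleftrightarrow> P A (compose (univ A) f e')"
    using ramsey_simultaneous[of ?\<C> \<A> Z] Z assms(9) unfolding ramsey_def by metis
  show "\<exists>Y\<in>order_reduct ` ?\<C>. \<forall>X'\<in>?\<C>. \<forall>Y'\<in>?\<C>.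
      order_reduct X' = X \<and> order_reduct Y' = Y \<longrightarrow> embeddings X' Y' \<noteq> {}"
  proof (intro bexI[OF _ imageI[OF C]] ballI impI, elim conjE)
    fix X' Y' assume X': "X' \<in> ?\<C>" "order_reduct X' = X"
      and Y': "Y' \<in> ?\<C>" "order_reduct Y' = order_reduct C"
    note YC = order_reduct_eqD[OF Y'(2)]
    obtain j where j: "j \<in> embeddings Y' \<Gamma>'" using Y'(1) by (auto simp: age_def)
    \<comment> \<open>A copy is coloured by whether \<open>Y'\<close> puts the image of
      \<open>0\<close> before that of \<open>1\<close>; this makes sense because \<open>C\<close>
      and \<open>Y'\<close> have the same domain.\<close>
    obtain f where f: "f \<in> embeddings Z C" and f_hom: "\<And>A e e'. A \<in> \<A> \<Longrightarrow>
        e \<in> embeddings A Z \<Longrightarrow> e' \<in> embeddings A Z \<Longrightarrow>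
        [compose (univ A) f e 0, compose (univ A) f e 1] \<in> rel Y' None \<longleftrightarrow>
        [compose (univ A) f e' 0, compose (univ A) f e' 1] \<in> rel Y' None"
      using C_hom[of "\<lambda>A e. [e 0, e 1] \<in> rel Y' None"] by metis
    have fY: "f z \<in> univ Y'" if "z \<in> univ Z" for z
      using embeddingsD(3)[OF f that] YC by simp
    have b_inj: "b z = b w \<longleftrightarrow> z = w" if "z \<in> univ Z" "w \<in> univ Z" for z w
      using embeddingsD(2)[OF b] that by (auto simp: inj_on_def)
    \<comment> \<open>The order of \<open>Y'\<close> on the copy \<open>f\<close> of
      \<open>Z\<close>, moved to \<open>T\<close> along \<open>b\<close>, where it can be compared
      with \<open>L\<close>.\<close>
    define R where "R = {(b z, b w) | z w. z \<in> univ Z \<and> w \<in> univ Z \<and> [f z, f w] \<in> rel Y' None}"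
    have R_iff: "(b z, b w) \<in> R \<longleftrightarrow> [f z, f w] \<in> rel Y' None"
      if "z \<in> univ Z" "w \<in> univ Z" for z w
      using that by (auto simp: R_def b_inj)
    \<comment> \<open>The order of \<open>Y'\<close> is inherited from \<open>L\<close> through
      \<open>j\<close>; this is the source of the linearity of \<open>R\<close>.\<close>
    have R_alt: "R = {(b z, b w) | z w. z \<in> univ Z \<and> w \<in> univ Z \<and> (j (f z), j (f w)) \<in> L}"
      unfolding R_def using order[OF j fY fY] by blast
    have jf: "j (f z) \<in> univ \<Gamma>" if "z \<in> univ Z" for z
      using embeddingsD(3)[OF j fY[OF that]] univ' by simp
    have jf_inj: "j (f z) = j (f w) \<longleftrightarrow> z = w" if "z \<in> univ Z" "w \<in> univ Z" for z w
      using embeddingsD(2)[OF j] embeddingsD(2)[OF f] fY that by (auto simp: inj_on_def)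
    have R_lin: "strict_linear_order_on T R"
      unfolding strict_linear_order_on_def
    proof (intro conjI)
      show "trans R"
      proof (rule transI)
        fix x y z assume "(x, y) \<in> R" "(y, z) \<in> R"
        then obtain u v w where "u \<in> univ Z" "v \<in> univ Z" "w \<in> univ Z" "x = b u" "z = b w"
          "(j (f u), j (f v)) \<in> L" "(j (f v), j (f w)) \<in> L"
          unfolding R_alt using b_inj by blast
        then show "(x, z) \<in> R"
          using L unfolding R_alt strict_linear_order_on_def by (blast dest: transD)
      qed
      show "irrefl R"
        using L b_inj by (auto simp: R_alt irrefl_def strict_linear_order_on_def)
      show "total_on T R"
        unfolding total_on_def
      proof (intro ballI impI)
        fix x y assume "x \<in> T" "y \<in> T" "x \<noteq> y"
        then obtain z w where "z \<in> univ Z" "w \<in> univ Z" "x = b z" "y = b w" "z \<noteq> w"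
          using bT by auto
        then show "(x, y) \<in> R \<or> (y, x) \<in> R"
          using L jf jf_inj unfolding R_alt strict_linear_order_on_def total_on_def by blast
      qed
    qed
    \<comment> \<open>Pairs of equal type come from two embeddings of one member of
      \<open>\<A>\<close> into \<open>Z\<close>, and \<open>f_hom\<close> gives these the same
      colour.\<close>
    have R_hom: "(p, q) \<in> R \<longleftrightarrow> (p', q') \<in> R"
      if pqs: "p \<in> T" "q \<in> T" "p \<noteq> q" "p' \<in> T" "q' \<in> T" "p' \<noteq> q'"
        and eq: "pair p q = pair p' q'"
      for p q p' q'
    proof -
      have "\<exists>e\<in>embeddings (pair p q) Z. b (e 0) = p \<and> b (e 1) = q"
        if pq: "p \<in> T" "q \<in> T" "p \<noteq> q" for p q
      proof -
        have "restrict (pt p q) {0, 1} \<in> embeddings (pair p q) \<Gamma>'"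
          unfolding pair_def by (rule pullback_embedding[OF pt[OF pq]])
        moreover have "restrict (pt p q) {0, 1} ` univ (pair p q) \<subseteq> b ` univ Z"
          using pq bT by (auto simp: pt_def pair_def)
        ultimately obtain e where "e \<in> embeddings (pair p q) Z"
          "\<And>i. i \<in> univ (pair p q) \<Longrightarrow> b (e i) = restrict (pt p q) {0, 1} i"
          using embedding_factor[OF _ b] by metis
        then show ?thesis by (intro bexI[of _ e]) (auto simp: pair_def pt_def)
      qed
      then obtain e e' where e: "e \<in> embeddings (pair p q) Z" "b (e 0) = p" "b (e 1) = q"
        and e': "e' \<in> embeddings (pair p q) Z" "b (e' 0) = p'" "b (e' 1) = q'"
        using pqs eq by metis
      have [simp]: "univ (pair p q) = {0, 1}" by (simp add: pair_def)
      have "[f (e 0), f (e 1)] \<in> rel Y' None \<longleftrightarrow> [f (e' 0), f (e' 1)] \<in> rel Y' None"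
        using f_hom[OF _ e(1) e'(1)] pqs by (auto simp: \<A>_def compose_eq)
      then show ?thesis
        using R_iff[of "e 0" "e 1"] R_iff[of "e' 0" "e' 1"] e e'
          embeddingsD(3)[OF e(1)] embeddingsD(3)[OF e'(1)] by simp
    qed
    \<comment> \<open>The pair \<open>(p, q)\<close> is taken from \<open>T\<^sub>0\<close>, since
      cycles were placed in \<open>T\<close> for the orbitals of such pairs.\<close>
    have orient: "((p, q) \<in> R \<longleftrightarrow> (p, q) \<in> L) \<longleftrightarrow> ((p', q') \<in> R \<longleftrightarrow> (p', q') \<in> L)"
      if pq: "p \<in> T\<^sub>0" "q \<in> T\<^sub>0" "p \<noteq> q" and pq': "(p', q') \<in> orb p q" "p' \<in> T" "q' \<in> T"
      for p q p' q'
    proof -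
      have p_dom: "p \<in> univ \<Gamma>" "q \<in> univ \<Gamma>" using pq T0 by auto
      have refl: "(p, q) \<in> orb p q"
        unfolding orb_def using id_in_Aut[of \<Gamma>] p_dom
        by (intro CollectI exI[of _ "\<lambda>x\<in>univ \<Gamma>. x"]) simp
      have irr: "u \<noteq> v" if "(u, v) \<in> orb p q" for u v
        using that pq(3) inj_on_eq_iff[OF embeddingsD(2)[OF Aut_embedding] p_dom]
        unfolding orb_def by blast
      have hom: "(u, v) \<in> R \<longleftrightarrow> (u', v') \<in> R"
        if uv: "(u, v) \<in> orb p q \<inter> T \<times> T" "(u', v') \<in> orb p q \<inter> T \<times> T"
          and same: "(u, v) \<in> L \<longleftrightarrow> (u', v') \<in> L" for u v u' v'
      proof (rule R_hom)
        obtain g g' where g: "g \<in> embeddings \<Gamma> \<Gamma>" "g' \<in> embeddings \<Gamma> \<Gamma>"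
          and "u = g p" "v = g q" "u' = g' p" "v' = g' q"
          using uv Aut_embedding by (fastforce simp: orb_def)
        then show "pair u v = pair u' v'"
          using pullback_pair_eq[OF L g p_dom] pq same by (simp add: pair_def pt_def \<Gamma>'_def)
      qed (use uv irr in auto)
      show ?thesis
      proof (cases "cyclic_orbital (orb p q)")
        case True
        then have us: "is_cycle (orb p q) (cyc p q)" using cyc pq by blast
        show ?thesis
        proof (rule same_orientation[where us = "cyc p q" and Q = "orb p q", OF R_lin])
          show "cyc p q \<noteq> []"
            "\<And>i. i < length (cyc p q) \<Longrightarrow>
              (cyc p q ! i, cyc p q ! (Suc i mod length (cyc p q))) \<in> orb p q"
            using us by (simp_all add: is_cycle_def)
          show "set (cyc p q) \<subseteq> T" using pq by (auto simp: T_def)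
          show "(p, q) \<in> orb p q \<inter> T \<times> T" using refl pq by (simp add: T_def)
          show "(p', q') \<in> orb p q \<inter> T \<times> T" using pq' by simp
        qed (fact hom irr)+
      next
        case False
        have "orb p q \<in> orbitals (Aut \<Gamma>) (univ \<Gamma>)"
          unfolding orb_def by (rule in_orbitalI) fact+
        then have "orb p q \<in> orbitals (Aut \<Gamma>') (univ \<Gamma>')"
          using assms(10) False by blast
        \<comment> \<open>On an orbital of \<open>Aut \<Gamma>'\<close> the status in
          \<open>L\<close> is constant, and by \<open>hom\<close> so is that in \<open>R\<close> for
          pairs within \<open>T\<close>.\<close>
        then have "(p, q) \<in> L \<longleftrightarrow> (p', q') \<in> L"
          unfolding \<Gamma>'_def univ_order_expansion
          by (rule orbital_of_Aut_order_expansion) (fact refl pq'(1))+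
        moreover from this have "(p, q) \<in> R \<longleftrightarrow> (p', q') \<in> R"
          using hom[of p q p' q'] refl pq pq' by (simp add: T_def)
        ultimately show ?thesis by blast
      qed
    qed
    have X'X: "X' \<in> \<X>" using X' by (simp add: \<X>_def)
    have copy: "\<exists>k\<in>embeddings X'' Z. \<forall>x\<in>univ X. b (k x) = h X'' x" if "X'' \<in> \<X>" for X''
    proof -
      have "h X'' ` univ X'' \<subseteq> b ` univ Z" using that bT by (auto simp: T_def T\<^sub>0_def)
      then show ?thesis using embedding_factor[OF h[OF that] b] univ_X[OF that] by metis
    qed
    obtain k where k: "k \<in> embeddings X' Z" and bk: "\<forall>x\<in>univ X. b (k x) = h X' x"
      using copy[OF X'X] by blast
    \<comment> \<open>This is \<open>X\<close> ordered as \<open>Y'\<close> orders the copy of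
      \<open>X'\<close> inside the copy of \<open>Z\<close>: by \<open>orient\<close>, the order of
      \<open>X'\<close> reversed on the orbitals where \<open>R\<close> disagrees with
      \<open>L\<close>. Its embedding into \<open>Y'\<close> puts it into the age, so
      \<open>Z\<close> contains a copy of it as well.\<close>
    define X'' where "X'' = pullback Y' (univ X) (\<lambda>x. f (k x))"
    have kZ: "k x \<in> univ Z" if "x \<in> univ X" for x
      using embeddingsD(3)[OF k] that univ_X[OF X'X] by simp
    have "(\<lambda>x. f (k x)) ` univ X \<subseteq> univ Y'" using kZ fY by auto
    moreover have "inj_on (\<lambda>x. f (k x)) (univ X)"
    proof (rule inj_onI)
      fix x y assume xy: "x \<in> univ X" "y \<in> univ X" "f (k x) = f (k y)"
      then have "k x = k y" using inj_onD[OF embeddingsD(2)[OF f]] kZ by blast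
      then show "x = y" using inj_onD[OF embeddingsD(2)[OF k]] univ_X[OF X'X] xy by blast
    qed
    ultimately have "restrict (\<lambda>x. f (k x)) (univ X) \<in> embeddings X'' Y'"
      unfolding X''_def by (rule pullback_embedding)
    moreover have "is_struct ?\<sigma> X''" "finite (univ X'')"
      using is_struct_pullback[OF age_str[OF Y'(1)]] fin_X by (simp_all add: X''_def)
    ultimately have X''_age: "X'' \<in> ?\<C>"
      using age_if_embedding[OF Y'(1)] by blast
    have "rel X'' (Some r) = rel X' (Some r)" for r
    proof -
      have "xs \<in> rel X' (Some r) \<longleftrightarrow> map (\<lambda>x. f (k x)) xs \<in> rel Y' (Some r)"
        if xs: "xs \<in> lists (univ X')" for xs
      proof -
        have "map k xs \<in> lists (univ Z)" using xs embeddingsD(3)[OF k] by auto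
        then show ?thesis
          using embeddingsD(4)[OF k xs, of "Some r"] embeddingsD(4)[OF f, of "map k xs" "Some r"] YC
          by (simp add: comp_def)
      qed
      moreover have "rel X' (Some r) \<subseteq> lists (univ X')"
        using age_str[OF X'(1), unfolded is_struct_def, rule_format, of "Some r"]
        by (auto split: option.splits)
      ultimately show ?thesis
        using univ_X[OF X'X] by (auto simp: X''_def pullback_def)
    qed
    then have "order_reduct X'' = X"
      using X'(2) by (auto simp: order_reduct_def X''_def)
    then have X''X: "X'' \<in> \<X>" using X''_age by (simp add: \<X>_def)
    obtain k'' where k'': "k'' \<in> embeddings X'' Z" and bk'': "\<forall>x\<in>univ X. b (k'' x) = h X'' x"
      using copy[OF X''X] by blast
    have k''Z: "k'' x \<in> univ Z" if "x \<in> univ X" for x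
      using embeddingsD(3)[OF k''] that univ_X[OF X''X] by simp
    have hX: "h X' \<in> embeddings X \<Gamma>" "h X'' \<in> embeddings X \<Gamma>"
      using order_reduct_embedding[OF h[OF X'X, unfolded \<Gamma>'_def]]
        order_reduct_embedding[OF h[OF X''X, unfolded \<Gamma>'_def]] X'(2) \<open>order_reduct X'' = X\<close>
      by simp_all
    \<comment> \<open>The chosen copies of \<open>X'\<close> and \<open>X''\<close> have the same
      reduct \<open>X\<close>, so homogeneity of \<open>\<Gamma>\<close> puts corresponding pairs
      into one orbital of \<open>Aut \<Gamma>\<close>.\<close>
    obtain g where g: "g \<in> Aut \<Gamma>" "\<And>x. x \<in> univ X \<Longrightarrow> g (h X' x) = h X'' x"
      using homogeneous_extend[OF assms(4) fin_X hX] by metis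
    have flip: "[x, y] \<in> rel X' None \<longleftrightarrow> [f (k'' x), f (k'' y)] \<in> rel Y' None"
      if xy: "x \<in> univ X" "y \<in> univ X" for x y
    proof (cases "x = y")
      \<comment> \<open>\<open>orient\<close> speaks of distinct points only; the diagonal is
        settled by irreflexivity.\<close>
      case True
      have "(h X' x, h X' x) \<notin> L" "(b (k'' x), b (k'' x)) \<notin> R"
        using L R_lin by (auto simp: strict_linear_order_on_def irrefl_def)
      then show ?thesis
        using order[OF h[OF X'X], of x x] R_iff[of "k'' x" "k'' x"] xy True k''Z univ_X[OF X'X]
        by simp
    next
      case False
      have "((h X' x, h X' y) \<in> R \<longleftrightarrow> (h X' x, h X' y) \<in> L) \<longleftrightarrow>
          ((h X'' x, h X'' y) \<in> R \<longleftrightarrow> (h X'' x, h X'' y) \<in> L)"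
      proof (rule orient)
        show "h X' x \<in> T\<^sub>0" "h X' y \<in> T\<^sub>0" "h X'' x \<in> T" "h X'' y \<in> T"
          using hT0[OF X'X] hT0[OF X''X] xy by (simp_all add: T_def)
        show "h X' x \<noteq> h X' y"
          using inj_on_eq_iff[OF embeddingsD(2)[OF hX(1)] xy] False by simp
        show "(h X'' x, h X'' y) \<in> orb (h X' x) (h X' y)"
          unfolding orb_def using g(1) g(2)[OF xy(1)] g(2)[OF xy(2)]
          by (intro CollectI exI[of _ g]) simp
      qed
      \<comment> \<open>This is how the order of \<open>X''\<close> was defined. It cancels two
        terms of the equivalence from \<open>orient\<close>, leaving \<open>L\<close> on the copy of
        \<open>X'\<close> equivalent to \<open>R\<close> on the copy of \<open>X''\<close>.\<close>
      moreover have "(h X' x, h X' y) \<in> R \<longleftrightarrow> (h X'' x, h X'' y) \<in> L"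
        using R_iff[of "k x" "k y"] order[OF h[OF X''X], of x y] xy kZ bk univ_X[OF X''X]
        by (simp add: X''_def pullback_def)
      moreover have "(h X' x, h X' y) \<in> L \<longleftrightarrow> [x, y] \<in> rel X' None"
        using order[OF h[OF X'X]] xy univ_X[OF X'X] by simp
      moreover have "(h X'' x, h X'' y) \<in> R \<longleftrightarrow> [f (k'' x), f (k'' y)] \<in> rel Y' None"
        using R_iff[of "k'' x" "k'' y"] xy k''Z bk'' by simp
      ultimately show ?thesis by blast
    qed
    \<comment> \<open>The relations of \<open>\<tau>\<close> are checked from \<open>X''\<close> to
      \<open>C\<close>, which share them with \<open>X'\<close> and \<open>Y'\<close>; the order is
      supplied by \<open>flip\<close>.\<close>
    have fk: "compose (univ X) f k'' \<in> embeddings X'' C"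
      using compose_in_embeddings[OF k'' f] univ_X[OF X''X] by simp
    have "compose (univ X) f k'' \<in> embeddings X' Y'"
    proof (rule embeddings_orderI[OF age_str[OF X'(1)] age_str[OF Y'(1)]])
      fix r xs assume "xs \<in> lists (univ X')"
      then show "xs \<in> rel X' (Some r) \<longleftrightarrow> map (compose (univ X) f k'') xs \<in> rel Y' (Some r)"
        using embeddingsD(4)[OF fk, of xs "Some r"] \<open>\<And>r. rel X'' (Some r) = rel X' (Some r)\<close>
          YC univ_X X'X X''X by simp
    qed (use flip embeddingsD(1,2)[OF fk] YC univ_X X'X X''X in \<open>simp_all add: compose_eq\<close>)
    then show "embeddings X' Y' \<noteq> {}" by blast
  qed
qed

end
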